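(* In the full shift $(\Sigma_2,\sigma)$, every minimal subshift $(Y,\sigma)$ is contained in an almost mean equicontinuous subshift $(X,\sigma)$ (that is, $Y\subset X$).
   Context: $\Sigma_2=\{0,1\}^{\mathbb{N}}$, $\mathbb{N}=\{1,2,\dots\}$, with the product topology and the compatible metric $d(x,y)=0$ if $x=y$ and $d(x,y)=1/i$ with $i=\min\{i\colon x_i\ne y_i\}$ if $x\neq y$. The shift $\sigma\colon\Sigma_2\to\Sigma_2$ is $\sigma(x)_n=x_{n+1}$. A subshift is $(X,\sigma)$ with $X\subset\Sigma_2$ nonempty, closed and $\sigma(X)\subset X$. For a compact metric space $(X,d)$ and continuous $T\colon X\to X$, let $\omega(x,T)=\bigcap_{N\ge0}\overline{\{T^nx\colon n\ge N\}}$; $(X,T)$ is transitive if $\omega(x,T)=X$ for some $x\in X$, and minimal if $\omega(x,T)=X$ for every $x\in X$. A point $x\in X$ is mean equicontinuous in $(X,T)$ if for every $\varepsilon>0$ there is $\delta>0$ such that for every $y\in X$ with $d(x,y)<\delta$, $\limsup_{n\to\infty}\frac1n\sum_{i=0}^{n-1}d(T^ix,T^iy)<\varepsilon$. A system is almost mean equicontinuous if it is transitive and has at least one mean equicontinuous point. *)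

theory Defs
  imports "HOL-Analysis.Analysis"
begin

section \<open>Topological dynamical systems\<close>

locale dynamical_system = Metric_space X d
  for X :: "'a set" and d :: "'a \<Rightarrow> 'a \<Rightarrow> real" +
  fixes T :: "'a \<Rightarrow> 'a"
  assumes compact: "compact_space mtopology"
    and continuous: "continuous_map mtopology mtopology T"
begin

definition omega_limit :: "'a \<Rightarrow> 'a set" where
  "omega_limit x = (\<Inter>N. mtopology closure_of {(T ^^ n) x |n. n \<ge> N})"

definition transitive :: bool where
  "transitive \<longleftrightarrow> (\<exists>x\<in>X. omega_limit x = X)"

definition minimal :: bool where
  "minimal \<longleftrightarrow> (\<forall>x\<in>X. omega_limit x = X)"

(* The averages are coerced to ereal only so that the limsup lives in a complete lattice;
   the n = 0 term is 0 / 0 = 0 and does not affect it. *)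
definition mean_equicontinuous_point :: "'a \<Rightarrow> bool" where
  "mean_equicontinuous_point x \<longleftrightarrow> x \<in> X \<and>
     (\<forall>\<epsilon>>0. \<exists>\<delta>>0. \<forall>y\<in>X. d x y < \<delta> \<longrightarrow>
        limsup (\<lambda>n. ereal ((\<Sum>i<n. d ((T ^^ i) x) ((T ^^ i) y)) / real n)) < ereal \<epsilon>)"

definition almost_mean_equicontinuous :: bool where
  "almost_mean_equicontinuous \<longleftrightarrow> transitive \<and> (\<exists>x. mean_equicontinuous_point x)"

end

section \<open>The full shift on two symbols\<close>

(* Symbols 0, 1 are represented by False, True, and positions by nat starting at 0:
   x n is the coordinate x_{n+1} of the 1-based convention. *)
type_synonym binseq = "nat \<Rightarrow> bool"

definition cantor_topology :: "binseq topology" where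
  "cantor_topology = product_topology (\<lambda>_. discrete_topology UNIV) UNIV"

(* The Suc accounts for 0-based positions: a first difference at position 0 gives distance 1. *)
definition cantor_dist :: "binseq \<Rightarrow> binseq \<Rightarrow> real" where
  "cantor_dist x y = (if x = y then 0 else 1 / real (Suc (LEAST i. x i \<noteq> y i)))"

definition shift :: "binseq \<Rightarrow> binseq" where
  "shift x = (\<lambda>n. x (Suc n))"

definition subshift :: "binseq set \<Rightarrow> bool" where
  "subshift X \<longleftrightarrow> X \<noteq> {} \<and> closedin cantor_topology X \<and> shift ` X \<subseteq> X"

section \<open>Subshifts are dynamical systems\<close>

lemma cantor_dist_nonneg: "0 \<le> cantor_dist x y"
  by (simp add: cantor_dist_def)

lemma cantor_dist_less_iff:
  "cantor_dist x y < 1 / real (Suc k) \<longleftrightarrow> (\<forall>i\<le>k. x i = y i)"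
proof (cases "x = y")
  case False
  then obtain j where j: "x j \<noteq> y j" by blast
  define m where "m = (LEAST i. x i \<noteq> y i)"
  have m: "x m \<noteq> y m" and least: "\<And>i. x i \<noteq> y i \<Longrightarrow> m \<le> i"
    unfolding m_def by (rule LeastI[where P = "\<lambda>i. x i \<noteq> y i", OF j], rule Least_le)
  have "cantor_dist x y < 1 / real (Suc k) \<longleftrightarrow> k < m"
    using False unfolding cantor_dist_def m_def[symmetric] by (simp add: field_simps)
  also have "\<dots> \<longleftrightarrow> (\<forall>i\<le>k. x i = y i)"
  proof
    assume "k < m"
    then show "\<forall>i\<le>k. x i = y i"
      using least by fastforce
  next
    assume "\<forall>i\<le>k. x i = y i"
    with m have "\<not> m \<le> k" by blast
    then show "k < m" by simp
  qed
  finally show ?thesis .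
qed (simp add: cantor_dist_def)

lemma cantor_dist_ultrametric:
  "cantor_dist x z \<le> max (cantor_dist x y) (cantor_dist y z)"
proof (cases "x = z")
  case True
  then show ?thesis
    using cantor_dist_nonneg[of x y] by (simp add: cantor_dist_def[of z z])
next
  case False
  define m where "m = (LEAST i. x i \<noteq> z i)"
  obtain j where j: "x j \<noteq> z j" using False by blast
  have "x m \<noteq> z m"
    unfolding m_def by (rule LeastI[where P = "\<lambda>i. x i \<noteq> z i", OF j])
  then have "\<not> (\<forall>i\<le>m. x i = y i) \<or> \<not> (\<forall>i\<le>m. y i = z i)" by force
  then have "1 / real (Suc m) \<le> max (cantor_dist x y) (cantor_dist y z)"
    unfolding cantor_dist_less_iff[symmetric] by linarith
  moreover have "cantor_dist x z = 1 / real (Suc m)"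
    using False by (simp add: cantor_dist_def m_def)
  ultimately show ?thesis by simp
qed

lemma Metric_space_cantor: "Metric_space UNIV cantor_dist"
proof
  fix x y z
  show "cantor_dist x z \<le> cantor_dist x y + cantor_dist y z"
    using cantor_dist_ultrametric[of x z y] cantor_dist_nonneg[of x y] cantor_dist_nonneg[of y z]
    by linarith
  have "(\<lambda>i. x i \<noteq> y i) = (\<lambda>i. y i \<noteq> x i)" by blast
  then show "cantor_dist x y = cantor_dist y x"
    unfolding cantor_dist_def by (simp only: eq_commute[of x y])
  show "cantor_dist x y = 0 \<longleftrightarrow> x = y"
    by (simp add: cantor_dist_def)
qed (rule cantor_dist_nonneg)

interpretation cantor: Metric_space UNIV cantor_dist
  by (rule Metric_space_cantor)

lemma openin_cantor_topology_cylinder: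
  "openin cantor_topology {y. \<forall>i\<le>k. y i = x i}"
proof -
  have "openin cantor_topology (PiE UNIV (\<lambda>i. if i \<le> k then {x i} else UNIV))"
    unfolding cantor_topology_def
  proof (rule product_topology_basis)
    show "finite {i. (if i \<le> k then {x i} else UNIV) \<noteq> topspace (discrete_topology UNIV)}"
      by (rule finite_subset[of _ "{..k}"]) auto
  qed simp
  moreover have "PiE UNIV (\<lambda>i. if i \<le> k then {x i} else UNIV) = {y. \<forall>i\<le>k. y i = x i}"
  proof (intro set_eqI iffI)
    fix y assume y: "y \<in> PiE UNIV (\<lambda>i. if i \<le> k then {x i} else UNIV)"
    have "y i = x i" if "i \<le> k" for i
      using PiE_mem[OF y, of i] that by simp
    then show "y \<in> {y. \<forall>i\<le>k. y i = x i}" by blast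
  qed (simp add: PiE_UNIV_domain)
  ultimately show ?thesis by simp
qed

lemma mtopology_cantor: "cantor.mtopology = cantor_topology"
proof (rule topology_eq[THEN iffD2], intro allI iffI)
  fix S
  assume S: "openin cantor.mtopology S"
  show "openin cantor_topology S"
  proof (subst openin_subopen, intro ballI)
    fix x assume "x \<in> S"
    with S obtain r where r: "r > 0" "cantor.mball x r \<subseteq> S"
      unfolding cantor.openin_mtopology by blast
    obtain k where k: "1 / real (Suc k) < r"
      using nat_approx_posE[OF r(1)] .
    have "{y. \<forall>i\<le>k. y i = x i} \<subseteq> S"
    proof
      fix y assume "y \<in> {y. \<forall>i\<le>k. y i = x i}"
      then have "cantor_dist x y < 1 / real (Suc k)"
        unfolding cantor_dist_less_iff by simp
      then have "y \<in> cantor.mball x r" using k by simp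
      then show "y \<in> S" using r by blast
    qed
    then show "\<exists>U. openin cantor_topology U \<and> x \<in> U \<and> U \<subseteq> S"
      using openin_cantor_topology_cylinder[of k x] by blast
  qed
next
  fix S
  assume S: "openin cantor_topology S"
  show "openin cantor.mtopology S"
    unfolding cantor.openin_mtopology
  proof (intro conjI allI impI subset_UNIV)
    fix x assume "x \<in> S"
    with S obtain U where U: "finite {i. U i \<noteq> UNIV}" "x \<in> PiE UNIV U" "PiE UNIV U \<subseteq> S"
      unfolding cantor_topology_def openin_product_topology_alt by auto
    obtain k where k: "\<And>i. U i \<noteq> UNIV \<Longrightarrow> i \<le> k"
      using U(1) unfolding finite_nat_set_iff_bounded_le by blast
    have "cantor.mball x (1 / real (Suc k)) \<subseteq> PiE UNIV U"
    proof
      fix y assume "y \<in> cantor.mball x (1 / real (Suc k))"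
      then have xy: "\<forall>i\<le>k. x i = y i"
        using cantor_dist_less_iff[of x y k] by (simp del: of_nat_Suc)
      have "y i \<in> U i" for i
      proof (cases "U i = UNIV")
        case False
        then have "x i = y i" using k xy by blast
        then show ?thesis using PiE_mem[OF U(2), of i] by simp
      qed blast
      then show "y \<in> PiE UNIV U"
        by (simp add: PiE_UNIV_domain)
    qed
    with U(3) have "cantor.mball x (1 / real (Suc k)) \<subseteq> S" by blast
    then show "\<exists>r>0. cantor.mball x r \<subseteq> S"
      by (intro exI[of _ "1 / real (Suc k)"]) simp
  qed
qed

lemma continuous_map_shift: "continuous_map cantor_topology cantor_topology shift"
  unfolding cantor_topology_def shift_def continuous_map_componentwise_UNIV
  by (intro allI continuous_map_product_projection UNIV_I)

lemma dynamical_system_subshift: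
  assumes "subshift X"
  shows "dynamical_system X cantor_dist shift"
proof -
  interpret Submetric UNIV cantor_dist X
    by unfold_locales auto
  have top: "sub.mtopology = subtopology cantor_topology X"
    by (simp add: mtopology_submetric mtopology_cantor)
  have "compact_space cantor_topology"
    by (simp add: cantor_topology_def compact_space_product_topology compact_space_discrete_topology)
  then have "compact_space sub.mtopology"
    using assms unfolding top subshift_def
    by (intro compact_space_subtopology closedin_compact_space) simp_all
  moreover have "continuous_map sub.mtopology sub.mtopology shift"
    using assms unfolding top subshift_def
    by (intro continuous_map_into_subtopology continuous_map_from_subtopology continuous_map_shift) auto
  ultimately show ?thesis
    by unfold_locales
qed

end

theory Submission
  imports Defs
begin

text \<open>
  If \<open>Y\<close> contains the zero sequence, then \<open>Y\<close> is that fixed point and \<open>X = Y\<close> works. Otherwise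
  some zero block of length \<open>L\<close> does not occur in \<open>y \<in> Y\<close>. Put \<open>A\<^sub>0 = 1 0\<^sup>L 1\<close> and
  \<open>A\<^sub>k\<^sub>+\<^sub>1 = A\<^sub>k 0\<^sup>a w\<^sub>k 0\<^sup>b A\<^sub>k\<close>, where \<open>w\<^sub>k\<close> is the prefix of \<open>y\<close> of length \<open>k\<close>, \<open>b = L + 1\<close> and \<open>a\<close>
  grows much faster than the number of ones in \<open>A\<^sub>k\<^sub>+\<^sub>1\<close>. The limit \<open>x\<close> of the \<open>A\<^sub>k\<close> is recurrent and its
  orbit closure \<open>X\<close> contains \<open>y\<close>, hence \<open>Y\<close>. The word \<open>A\<^sub>0\<close> occurs in \<open>x\<close> only where the
  construction puts it, and every such occurrence is followed by ones of density zero, at a uniform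
  rate. The rate passes to every point of \<open>X\<close> that starts with \<open>A\<^sub>0\<close>, so all these points are mean
  asymptotic to \<open>x\<close>.
\<close>

section \<open>Limit sets in subshifts\<close>

lemma shift_funpow: "(shift ^^ n) x = (\<lambda>i. x (n + i))"
  by (induction n) (simp_all add: shift_def)

lemma cantor_dist_less_iff_lessThan:
  "0 < n \<Longrightarrow> cantor_dist x y < 1 / real n \<longleftrightarrow> (\<forall>i<n. x i = y i)"
  using cantor_dist_less_iff[of x y "n - 1"] by (cases n) (simp_all add: less_Suc_eq_le)

text \<open>Balls of radius \<open>1 / real (Suc n)\<close> are cylinders. The space is a parameter
  so that the criterion serves subshifts and the full shift alike.\<close>

lemma cantor_closure_of_iff:
  assumes "Metric_space X cantor_dist"
  shows "z \<in> Metric_space.mtopology X cantor_dist closure_of S \<longleftrightarrow>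
    z \<in> X \<and> (\<forall>n. \<exists>w\<in>S \<inter> X. \<forall>i<n. z i = w i)"
proof -
  interpret Metric_space X cantor_dist by fact
  have "(\<forall>r>0. \<exists>w\<in>S. w \<in> mball z r) \<longleftrightarrow> (\<forall>n. \<exists>w\<in>S \<inter> X. \<forall>i<n. z i = w i)"
    if "z \<in> X"
  proof (intro iffI allI impI)
    fix n
    assume "\<forall>r>0. \<exists>w\<in>S. w \<in> mball z r"
    then obtain w where "w \<in> S" "w \<in> mball z (1 / real (Suc n))"
      by (meson of_nat_0_less_iff zero_less_Suc zero_less_divide_1_iff)
    then show "\<exists>w\<in>S \<inter> X. \<forall>i<n. z i = w i"
      using cantor_dist_less_iff[of z w n] by (intro bexI[of _ w]) (auto simp del: of_nat_Suc)
  next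
    fix r :: real
    assume *: "\<forall>n. \<exists>w\<in>S \<inter> X. \<forall>i<n. z i = w i" and "0 < r"
    obtain k where k: "1 / real (Suc k) < r"
      using nat_approx_posE[OF \<open>0 < r\<close>] .
    obtain w where "w \<in> S \<inter> X" "\<forall>i<Suc k. z i = w i"
      using * by blast
    then show "\<exists>w\<in>S. w \<in> mball z r"
      using k \<open>z \<in> X\<close> cantor_dist_less_iff[of z w k]
      by (intro bexI[of _ w]) (auto simp: less_Suc_eq_le simp del: of_nat_Suc)
  qed
  then show ?thesis
    by (auto simp: metric_closure_of)
qed

lemma subshift_orbit:
  assumes "subshift X" "x \<in> X"
  shows "(\<lambda>i. x (m + i)) \<in> X"
proof -
  have "(shift ^^ m) x \<in> X"
    using assms unfolding subshift_def by (induction m) auto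
  then show ?thesis by (simp add: shift_funpow)
qed

lemma omega_limit_iff:
  assumes "subshift X" "x \<in> X"
  shows "z \<in> dynamical_system.omega_limit X cantor_dist shift x \<longleftrightarrow>
    z \<in> X \<and> (\<forall>n N. \<exists>m\<ge>N. \<forall>i<n. z i = x (m + i))"
proof -
  interpret dynamical_system X cantor_dist shift
    by (rule dynamical_system_subshift) fact
  have orbit: "{(shift ^^ n) x |n. n \<ge> N} \<inter> X = (\<lambda>m i. x (m + i)) ` {N..}" for N
    using subshift_orbit[OF assms] by (auto simp: shift_funpow)
  show ?thesis
    unfolding omega_limit_def INT_iff cantor_closure_of_iff[OF Metric_space_axioms] orbit bex_simps
    by (auto simp: Bex_def)
qed

lemma subshift_closed:
  assumes "subshift X" "\<And>n. \<exists>w\<in>X. \<forall>i<n. z i = w i"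
  shows "z \<in> X"
proof -
  have "z \<in> cantor_topology closure_of X"
    using assms(2) cantor_closure_of_iff[OF Metric_space_cantor, of z X]
    by (simp add: mtopology_cantor)
  moreover have "cantor_topology closure_of X = X"
    using assms(1) by (simp add: subshift_def closure_of_closedin)
  ultimately show ?thesis by simp
qed

text \<open>Combinatorial form of the closure of the orbit; it lets bounds on finite windows pass
  from \<open>x\<close> to every point of the closure.\<close>

definition orbit_closure :: "binseq \<Rightarrow> binseq set" where
  "orbit_closure x = {z. \<forall>n. \<exists>p. \<forall>i<n. z i = x (p + i)}"

lemma orbit_closure_refl: "x \<in> orbit_closure x"
  unfolding orbit_closure_def by (auto intro: exI[of _ 0])

lemma subshift_orbit_closure: "subshift (orbit_closure x)"
  unfolding subshift_def
proof (intro conjI)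
  show "orbit_closure x \<noteq> {}"
    using orbit_closure_refl by blast
  have "cantor_topology closure_of orbit_closure x \<subseteq> orbit_closure x"
  proof
    fix z assume "z \<in> cantor_topology closure_of orbit_closure x"
    then have *: "\<exists>w\<in>orbit_closure x. \<forall>i<n. z i = w i" for n
      using cantor_closure_of_iff[OF Metric_space_cantor, of z "orbit_closure x"]
      by (simp add: mtopology_cantor)
    have "\<exists>p. \<forall>i<n. z i = x (p + i)" for n
    proof -
      obtain w where w: "w \<in> orbit_closure x" "\<forall>i<n. z i = w i"
        using * by blast
      then obtain p where "\<forall>i<n. w i = x (p + i)"
        unfolding orbit_closure_def by blast
      with w(2) show ?thesis by auto
    qed
    then show "z \<in> orbit_closure x"
      unfolding orbit_closure_def by blast
  qed
  then show "closedin cantor_topology (orbit_closure x)"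
    by (subst closure_of_subset_eq[symmetric]) (simp add: cantor_topology_def)
  show "shift ` orbit_closure x \<subseteq> orbit_closure x"
  proof (rule image_subsetI)
    fix z assume z: "z \<in> orbit_closure x"
    have "\<exists>p. \<forall>i<n. shift z i = x (p + i)" for n
    proof -
      obtain p where "\<forall>i<Suc n. z i = x (p + i)"
        using z unfolding orbit_closure_def by blast
      then show ?thesis
        unfolding shift_def by (intro exI[of _ "Suc p"]) auto
    qed
    then show "shift z \<in> orbit_closure x"
      unfolding orbit_closure_def by blast
  qed
qed

section \<open>Sequences with ones of density zero\<close>

definition sparse :: "binseq \<Rightarrow> bool" where
  "sparse z \<longleftrightarrow> (\<forall>K. \<exists>n0. \<forall>n\<ge>n0. K * card {i. i < n \<and> z i} \<le> n)"

text \<open>For the first \<open>k = Suc j\<close> with \<open>n \<le> a k\<close>, the count up to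
  \<open>n\<close> is at most \<open>c (Suc j)\<close>, while
  \<open>n > a j \<ge> Suc j * c (Suc j)\<close>.\<close>

lemma sparseI:
  fixes a c :: "nat \<Rightarrow> nat"
  assumes z: "\<And>k. card {i. i < a k \<and> z i} \<le> c k"
    and ca: "\<And>k. Suc k * c (Suc k) \<le> a k"
    and a: "\<And>k. k < a k"
  shows "sparse z"
  unfolding sparse_def
proof (intro allI exI impI)
  fix K n :: nat
  \<comment> \<open>Beyond all of \<open>a 0, ..., a K\<close>, the first \<open>k\<close> with
    \<open>n \<le> a k\<close> must exceed \<open>K\<close>.\<close>
  assume n: "Max (a ` {..K}) + 1 \<le> n"
  have "\<exists>k. n \<le> a k"
    using a[of n] by (auto intro: less_imp_le)
  then obtain k where k: "n \<le> a k" "\<And>i. i < k \<Longrightarrow> \<not> n \<le> a i"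
    using exists_least_iff[of "\<lambda>k. n \<le> a k"] by blast
  have "K < k"
  proof (rule ccontr)
    assume "\<not> K < k"
    then have "a k \<le> Max (a ` {..K})" by simp
    with k(1) n show False by simp
  qed
  then obtain j where j: "k = Suc j" by (cases k) auto
  have "card {i. i < n \<and> z i} \<le> card {i. i < a k \<and> z i}"
    using k(1) by (intro card_mono) auto
  then have "card {i. i < n \<and> z i} \<le> c k"
    using z[of k] by linarith
  then have "K * card {i. i < n \<and> z i} \<le> Suc j * c (Suc j)"
    using \<open>K < k\<close> unfolding j by (intro mult_mono) auto
  also have "\<dots> \<le> a j" by (rule ca)
  also have "\<dots> \<le> n" using k(2)[of j] j by simp
  finally show "K * card {i. i < n \<and> z i} \<le> n" .
qed

text \<open>Double counting: for each offset \<open>s < m\<close>, a one is counted at most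
  once.\<close>

lemma sum_indicator_window_le:
  "(\<Sum>i<n. card {s. s < m \<and> z (i + s)}) \<le> m * card {i. i < n + m \<and> z i}"
proof -
  have "(\<Sum>i<n. card {s. s < m \<and> z (i + s)}) = (\<Sum>i<n. \<Sum>s<m. of_bool (z (i + s)))"
    by (intro sum.cong refl) (simp add: sum_of_bool_eq Int_def)
  also have "\<dots> = (\<Sum>s<m. \<Sum>i<n. of_bool (z (i + s)))"
    by (rule sum.swap)
  also have "\<dots> = (\<Sum>s<m. card {i. i < n \<and> z (i + s)})"
    by (intro sum.cong refl) (simp add: sum_of_bool_eq Int_def)
  also have "\<dots> \<le> (\<Sum>s<m. card {i. i < n + m \<and> z i})"
  proof (intro sum_mono)
    fix s assume s: "s \<in> {..<m}"
    have "card {i. i < n \<and> z (i + s)} = card ((\<lambda>i. i + s) ` {i. i < n \<and> z (i + s)})"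
      by (subst card_image) auto
    also have "\<dots> \<le> card {i. i < n + m \<and> z i}"
      using s by (intro card_mono) auto
    finally show "card {i. i < n \<and> z (i + s)} \<le> card {i. i < n + m \<and> z i}" .
  qed
  finally show ?thesis by simp
qed

text \<open>If the distance is at least \<open>1 / m\<close>, one of the two windows contains a one,
  and distances never exceed 1.\<close>

lemma cantor_dist_le_window:
  assumes "0 < m"
  shows "cantor_dist x z \<le> 1 / real m + real (card {s. s < m \<and> x s}) + real (card {s. s < m \<and> z s})"
proof (cases "cantor_dist x z < 1 / real m")
  case False
  then obtain s where s: "s < m" "x s \<noteq> z s"
    using cantor_dist_less_iff_lessThan[OF assms] by blast
  have "1 \<le> card {s. s < m \<and> x s} + card {s. s < m \<and> z s}"
  proof (cases "x s")
    case True
    then have "{s. s < m \<and> x s} \<noteq> {}" using s by blast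
    then have "0 < card {s. s < m \<and> x s}" by (simp add: card_gt_0_iff)
    then show ?thesis by simp
  next
    case False
    then have "{s. s < m \<and> z s} \<noteq> {}" using s by blast
    then have "0 < card {s. s < m \<and> z s}" by (simp add: card_gt_0_iff)
    then show ?thesis by simp
  qed
  then have "1 \<le> real (card {s. s < m \<and> x s}) + real (card {s. s < m \<and> z s})"
    by linarith
  moreover have "cantor_dist x z \<le> 1"
    by (simp add: cantor_dist_def)
  moreover have "0 \<le> 1 / real m" by simp
  ultimately show ?thesis by linarith
qed (smt (verit) of_nat_0_le_iff)

lemma sparse_mean_asymptotic:
  assumes x: "sparse x" and z: "sparse z"
  shows "(\<lambda>n. (\<Sum>i<n. cantor_dist ((shift ^^ i) x) ((shift ^^ i) z)) / real n) \<longlonglongrightarrow> 0"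
proof (rule LIMSEQ_I)
  fix e :: real
  assume "0 < e"
  \<comment> \<open>The final estimate of the average is \<open>5 / m\<close>, which is below
    \<open>e\<close> by this choice.\<close>
  then obtain m where m: "0 < m" "1 / real m < e / 8"
    using nat_approx_posE[of "e / 8"] by (metis zero_less_Suc zero_less_divide_iff zero_less_numeral)
  \<comment> \<open>Each one costs a factor \<open>m\<close> in the window sums, so frequency
    \<open>1 / m^2\<close> leaves an error of order \<open>1 / m\<close>.\<close>
  define K where "K = m * m"
  have K: "0 < K" using m by (simp add: K_def)
  obtain n1 where n1: "\<And>n. n1 \<le> n \<Longrightarrow> K * card {i. i < n \<and> x i} \<le> n"
    using x unfolding sparse_def by blast
  obtain n2 where n2: "\<And>n. n2 \<le> n \<Longrightarrow> K * card {i. i < n \<and> z i} \<le> n"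
    using z unfolding sparse_def by blast
  show "\<exists>n0. \<forall>n\<ge>n0. norm ((\<Sum>i<n. cantor_dist ((shift ^^ i) x) ((shift ^^ i) z)) / real n - 0) < e"
  proof (intro exI allI impI)
    fix n
    \<comment> \<open>From \<open>m < n\<close> comes \<open>n + m \<le> 2 * n\<close>, the source
      of the factor 2 below.\<close>
    assume n: "max (max n1 n2) (Suc m) \<le> n"
    then have "0 < n" by simp
    let ?S = "\<Sum>i<n. cantor_dist ((shift ^^ i) x) ((shift ^^ i) z)"
    have bound: "m * real (m * card {i. i < n + m \<and> u i}) \<le> 2 * real n"
      if "K * card {i. i < n + m \<and> u i} \<le> n + m" for u
    proof -
      have "m * (m * card {i. i < n + m \<and> u i}) \<le> 2 * n"
        using that n by (simp add: K_def mult.assoc)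
      then have "real (m * (m * card {i. i < n + m \<and> u i})) \<le> real (2 * n)"
        by (rule of_nat_mono)
      then show ?thesis by simp
    qed
    have "?S \<le> (\<Sum>i<n. 1 / real m + real (card {s. s < m \<and> x (i + s)}) + real (card {s. s < m \<and> z (i + s)}))"
      unfolding shift_funpow by (intro sum_mono cantor_dist_le_window m(1))
    also have "\<dots> = real n / real m + real (\<Sum>i<n. card {s. s < m \<and> x (i + s)})
        + real (\<Sum>i<n. card {s. s < m \<and> z (i + s)})"
      by (simp add: sum.distrib)
    also have "\<dots> \<le> real n / real m + real (m * card {i. i < n + m \<and> x i}) + real (m * card {i. i < n + m \<and> z i})"
      by (intro add_mono of_nat_mono sum_indicator_window_le order_refl)
    also have "\<dots> \<le> real n / real m + 2 * real n / real m + 2 * real n / real m"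
    proof (intro add_mono order_refl)
      show "real (m * card {i. i < n + m \<and> x i}) \<le> 2 * real n / real m"
        using bound[of x] n1[of "n + m"] n m(1) by (simp add: pos_le_divide_eq mult.commute)
      show "real (m * card {i. i < n + m \<and> z i}) \<le> 2 * real n / real m"
        using bound[of z] n2[of "n + m"] n m(1) by (simp add: pos_le_divide_eq mult.commute)
    qed
    also have "\<dots> = 5 * (1 / real m) * real n" by simp
    also have "\<dots> < e * real n"
      using m(2) \<open>0 < n\<close> \<open>0 < e\<close> by (intro mult_strict_right_mono) auto
    finally have "?S / real n < e"
      using \<open>0 < n\<close> by (simp add: pos_divide_less_eq)
    moreover have "0 \<le> ?S / real n"
      by (intro divide_nonneg_nonneg sum_nonneg cantor_dist_nonneg) simp
    ultimately show "norm (?S / real n - 0) < e" by simp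
  qed
qed

section \<open>The recurrent point\<close>

text \<open>The factor \<open>2 * 3 ^ Suc k\<close> bounds the number of ones in \<open>A\<^sub>k\<^sub>+\<^sub>1\<close> (see \<open>card_ones\<close>).\<close>

definition gap :: "nat \<Rightarrow> nat \<Rightarrow> nat" where
  "gap L k = Suc k * (2 * 3 ^ Suc k) + L + 1"

text \<open>The length of \<open>A\<^sub>k\<close>, with \<open>a = gap L k\<close> and
  \<open>b = L + 1\<close>.\<close>

fun len :: "nat \<Rightarrow> nat \<Rightarrow> nat" where
  "len L 0 = L + 2"
| "len L (Suc k) = 2 * len L k + gap L k + k + L + 1"

abbreviation word_pos :: "nat \<Rightarrow> nat \<Rightarrow> nat" where
  "word_pos L k \<equiv> len L k + gap L k"

abbreviation copy_pos :: "nat \<Rightarrow> nat \<Rightarrow> nat" where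
  "copy_pos L k \<equiv> len L k + gap L k + k + L + 1"

text \<open>The set of positions of the ones in \<open>A\<^sub>k\<close>.\<close>

fun ones :: "nat \<Rightarrow> binseq \<Rightarrow> nat \<Rightarrow> nat set" where
  "ones L y 0 = {0, Suc L}"
| "ones L y (Suc k) = ones L y k \<union> (+) (word_pos L k) ` {s. s < k \<and> y s}
     \<union> (+) (copy_pos L k) ` ones L y k"

text \<open>The sets \<open>ones L y k\<close> increase with \<open>k\<close>, so the limit of the
  words is their union.\<close>

definition recurrent_point :: "nat \<Rightarrow> binseq \<Rightarrow> binseq" where
  "recurrent_point L y t \<longleftrightarrow> (\<exists>k. t \<in> ones L y k)"

text \<open>An occurrence of \<open>A\<^sub>0\<close>, the marker. It is applied both to the limit
  sequence and to the finite stages.\<close>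

definition marked :: "nat \<Rightarrow> binseq \<Rightarrow> nat \<Rightarrow> bool" where
  "marked L x p \<longleftrightarrow> x p \<and> x (p + Suc L) \<and> (\<forall>i. 0 < i \<and> i \<le> L \<longrightarrow> \<not> x (p + i))"

lemma gap_gt: "L < gap L k" "k < gap L k"
proof -
  have "Suc k * 1 \<le> Suc k * (2 * 3 ^ Suc k)"
    by (intro mult_le_mono2) simp
  also have "\<dots> \<le> gap L k"
    unfolding gap_def add.assoc by (rule le_add1)
  finally show "k < gap L k" by simp
qed (simp add: gap_def)

lemma gap_mono: "j \<le> k \<Longrightarrow> gap L j \<le> gap L k"
  unfolding gap_def by (intro add_mono mult_mono power_increasing) auto

lemma ones_less: "t \<in> ones L y k \<Longrightarrow> t < len L k"
  by (induction k arbitrary: t) fastforce+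

lemma finite_ones: "finite (ones L y k)"
  by (induction k) auto

text \<open>Each stage doubles the ones and adds at most \<open>k < 3 ^ k\<close> more, so a factor
  3 suffices.\<close>

lemma card_ones: "card (ones L y k) \<le> 2 * 3 ^ k"
proof (induction k)
  case (Suc k)
  have "card {s. s < k \<and> y s} \<le> card {..<k}"
    by (intro card_mono) auto
  then have w: "card ((+) (word_pos L k) ` {s. s < k \<and> y s}) \<le> k"
    by (simp add: card_image)
  have c: "card ((+) (copy_pos L k) ` ones L y k) = card (ones L y k)"
    by (intro card_image inj_onI) simp
  have "card (ones L y (Suc k)) \<le> card (ones L y k) + card ((+) (word_pos L k) ` {s. s < k \<and> y s})
      + card ((+) (copy_pos L k) ` ones L y k)"
    by (simp only: ones.simps) (intro order_trans[OF card_Un_le] add_mono card_Un_le order_refl)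
  also have "\<dots> \<le> 2 * 3 ^ k + k + 2 * 3 ^ k"
    unfolding c by (intro add_mono Suc w)
  also have "\<dots> \<le> 2 * 3 ^ Suc k"
  proof -
    have "k < 2 ^ k" by (rule less_exp)
    also have "\<dots> \<le> 3 ^ k" by (rule power_mono) simp_all
    finally show ?thesis by simp
  qed
  finally show ?case .
qed (simp add: card_insert_if)

section \<open>Finite words, their limit, and the markers in them\<close>

lemma ones_Suc_iff:
  "t < word_pos L k \<Longrightarrow> t \<in> ones L y (Suc k) \<longleftrightarrow> t \<in> ones L y k"
  by auto

lemma len_mono: "j \<le> k \<Longrightarrow> len L j \<le> len L k"
  by (induction k rule: dec_induct) auto

lemma ones_iff_le:
  "j \<le> k \<Longrightarrow> t < word_pos L j \<Longrightarrow> t \<in> ones L y k \<longleftrightarrow> t \<in> ones L y j"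
proof (induction k rule: dec_induct)
  case (step k)
  then have "t < word_pos L k"
    using len_mono[of j k L] gap_mono[of j k L] by linarith
  then show ?case
    using ones_Suc_iff step by metis
qed simp

text \<open>The bound exceeds \<open>len L k\<close> because the zeros that follow the first
  \<open>A\<^sub>k\<close> are never overwritten at later stages.\<close>

lemma recurrent_point_iff:
  assumes "t < word_pos L k"
  shows "recurrent_point L y t \<longleftrightarrow> t \<in> ones L y k"
proof
  assume "recurrent_point L y t"
  then obtain j where j: "t \<in> ones L y j" by (auto simp: recurrent_point_def)
  show "t \<in> ones L y k"
  proof (cases "j \<le> k")
    case True
    have "t < word_pos L j" using ones_less[OF j] by simp
    then show ?thesis using ones_iff_le[OF True] j by blast
  qed (use ones_iff_le[of k j t] assms j in auto)
qed (auto simp: recurrent_point_def)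

lemma le_len: "k \<le> len L k"
  by (induction k) auto

lemma recurrent_point_iff_le: "t \<le> k \<Longrightarrow> recurrent_point L y t \<longleftrightarrow> t \<in> ones L y k"
  using le_len[of k L] gap_gt(2)[of k L] by (intro recurrent_point_iff) linarith

text \<open>The second copy of \<open>A\<^sub>k\<close> makes prefixes return arbitrarily late;
  transitivity rests on this.\<close>

lemma recurrent_point_copy:
  "t < len L k \<Longrightarrow> recurrent_point L y (copy_pos L k + t) \<longleftrightarrow> recurrent_point L y t"
proof -
  assume t: "t < len L k"
  have "recurrent_point L y (copy_pos L k + t) \<longleftrightarrow> copy_pos L k + t \<in> ones L y (Suc k)"
    using t by (intro recurrent_point_iff) simp
  also have "\<dots> \<longleftrightarrow> t \<in> ones L y k"
    using ones_less[of "copy_pos L k + t" L y k] by auto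
  also have "\<dots> \<longleftrightarrow> recurrent_point L y t"
    using t by (intro recurrent_point_iff[symmetric]) simp
  finally show ?thesis .
qed

lemma recurrent_point_word:
  "t < k \<Longrightarrow> recurrent_point L y (word_pos L k + t) \<longleftrightarrow> y t"
proof -
  assume t: "t < k"
  have "recurrent_point L y (word_pos L k + t) \<longleftrightarrow> word_pos L k + t \<in> ones L y (Suc k)"
    using t by (intro recurrent_point_iff) simp
  also have "\<dots> \<longleftrightarrow> y t"
    using t ones_less[of "word_pos L k + t" L y k] by auto
  finally show ?thesis .
qed

text \<open>Both runs of zeros are longer than \<open>L\<close>, so no marker bridges them, and the
  inserted word contains no \<open>L\<close> consecutive zeros after a one. Hence each marker of
  \<open>A\<^sub>k\<^sub>+\<^sub>1\<close> comes from a copy of \<open>A\<^sub>k\<close>.\<close>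

lemma marked_ones_Suc:
  assumes y: "\<And>s. \<exists>i. 0 < i \<and> i \<le> L \<and> y (s + i)"
    and p: "marked L (\<lambda>t. t \<in> ones L y (Suc k)) p"
  shows "marked L (\<lambda>t. t \<in> ones L y k) p \<and> p < len L k \<or>
    (\<exists>p'. p = copy_pos L k + p' \<and> marked L (\<lambda>t. t \<in> ones L y k) p')"
proof -
  have "p \<in> ones L y (Suc k)"
    using p by (simp add: marked_def)
  then consider "p \<in> ones L y k"
    | s where "p = word_pos L k + s" "s < k" "y s"
    | p' where "p = copy_pos L k + p'" "p' \<in> ones L y k"
    by auto
  then show ?thesis
  proof cases
    case 1
    then have *: "p < len L k" by (rule ones_less)
    then have "p + i \<in> ones L y (Suc k) \<longleftrightarrow> p + i \<in> ones L y k" if "i \<le> Suc L" for i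
      using that gap_gt(1)[of L k] by (intro ones_Suc_iff) linarith
    from this[of 0] this[of "Suc L"] this p * show ?thesis
      by (simp add: marked_def del: ones.simps)
  next
    case 2
    obtain i where i: "0 < i" "i \<le> L" "y (s + i)" using y by blast
    have "p + Suc L \<in> ones L y (Suc k)" using p by (simp add: marked_def)
    \<comment> \<open>The second copy starts \<open>L + 1\<close> places after the end of the word,
      too far for the last one of the marker.\<close>
    then have "s + Suc L < k"
      using 2 ones_less[of "p + Suc L" L y k] by auto
    then have "p + i \<in> ones L y (Suc k)"
      using 2 i by (auto simp: add.assoc)
    then show ?thesis
      using p i by (auto simp: marked_def)
  next
    case 3
    have "p + i \<in> ones L y (Suc k) \<longleftrightarrow> p' + i \<in> ones L y k" for i
      using 3 ones_less[of "p + i" L y k] by (auto simp: add.assoc)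
    from this[of 0] this[of "Suc L"] this p show ?thesis
      using 3 by (auto simp: marked_def simp del: ones.simps)
  qed
qed

text \<open>For \<open>k \<le> j\<close> all ones of \<open>A\<^sub>k\<close> together obey the
  bound. At larger stages the window reduces to the previous one: after a marker in the first copy
  it ends before the word, as \<open>gap L j \<le> gap L k\<close>, and nothing follows the second
  copy.\<close>

lemma card_ones_after_marker:
  assumes y: "\<And>s. \<exists>i. 0 < i \<and> i \<le> L \<and> y (s + i)"
  shows "marked L (\<lambda>t. t \<in> ones L y k) p \<Longrightarrow> card {i. i < gap L j \<and> p + i \<in> ones L y k} \<le> 2 * 3 ^ j"
proof (induction k arbitrary: p)
  have total: "card {i. i < gap L j \<and> p + i \<in> ones L y k} \<le> 2 * 3 ^ j" if "k \<le> j" for k p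
  proof -
    have "card {i. i < gap L j \<and> p + i \<in> ones L y k} = card ((+) p ` {i. i < gap L j \<and> p + i \<in> ones L y k})"
      by (simp add: card_image)
    also have "\<dots> \<le> card (ones L y k)"
      by (intro card_mono finite_ones) auto
    also have "\<dots> \<le> 2 * 3 ^ k" by (rule card_ones)
    also have "\<dots> \<le> 2 * 3 ^ j" using that by (simp add: power_increasing)
    finally show ?thesis .
  qed
  {
    case 0
    show ?case by (rule total) simp
  next
    case (Suc k)
    show ?case
    proof (cases "Suc k \<le> j")
      case False
      from marked_ones_Suc[OF y Suc.prems] show ?thesis
      proof (elim disjE conjE exE)
        assume p: "marked L (\<lambda>t. t \<in> ones L y k) p" "p < len L k"
        have "p + i \<in> ones L y (Suc k) \<longleftrightarrow> p + i \<in> ones L y k" if "i < gap L j" for i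
          using that p(2) False gap_mono[of j k L] by (intro ones_Suc_iff) linarith
        then show ?thesis
          using Suc.IH[OF p(1)] by (simp cong: conj_cong del: ones.simps)
      next
        fix p'
        assume p': "p = copy_pos L k + p'" "marked L (\<lambda>t. t \<in> ones L y k) p'"
        have "p + i \<in> ones L y (Suc k) \<longleftrightarrow> p' + i \<in> ones L y k" for i
          using p'(1) ones_less[of "p + i" L y k] by (auto simp: add.assoc)
        then show ?thesis
          using Suc.IH[OF p'(2)] by (simp del: ones.simps)
      qed
    qed (rule total)
  }
qed

lemma card_recurrent_point_after_marker:
  assumes y: "\<And>s. \<exists>i. 0 < i \<and> i \<le> L \<and> y (s + i)"
    and p: "marked L (recurrent_point L y) p"
  shows "card {i. i < gap L j \<and> recurrent_point L y (p + i)} \<le> 2 * 3 ^ j"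
proof -
  \<comment> \<open>A stage that agrees with the limit on both the window and the marker at
    \<open>p\<close>.\<close>
  define k where "k = p + gap L j + Suc L"
  have eq: "recurrent_point L y (p + i) \<longleftrightarrow> p + i \<in> ones L y k" if "i < gap L j \<or> i \<le> Suc L" for i
    using that by (intro recurrent_point_iff_le) (auto simp: k_def)
  have "marked L (\<lambda>t. t \<in> ones L y k) p"
    using p eq[of 0] eq[of "Suc L"] eq by (simp add: marked_def)
  from card_ones_after_marker[OF y this, of j] show ?thesis
    using eq by (simp cong: conj_cong)
qed

text \<open>The bound after a marker does not depend on its position, so it survives the passage to
  the orbit closure.\<close>

lemma sparse_of_marked:
  assumes y: "\<And>s. \<exists>i. 0 < i \<and> i \<le> L \<and> y (s + i)"
    and z: "z \<in> orbit_closure (recurrent_point L y)" "marked L z 0"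
  shows "sparse z"
proof (rule sparseI)
  fix j
  \<comment> \<open>The prefix covers the window and the \<open>L + 2\<close> symbols of the marker,
    so that \<open>p\<close> is marked too.\<close>
  obtain p where p: "\<And>i. i < gap L j + L + 2 \<Longrightarrow> z i = recurrent_point L y (p + i)"
    using z(1) unfolding orbit_closure_def by blast
  have "marked L (recurrent_point L y) p"
    using z(2) p[of 0] p[of "Suc L"] p by (simp add: marked_def)
  from card_recurrent_point_after_marker[OF y this, of j]
  show "card {i. i < gap L j \<and> z i} \<le> 2 * 3 ^ j"
    using p by (simp cong: conj_cong)
next
  fix k
  show "Suc k * (2 * 3 ^ Suc k) \<le> gap L k" by (simp add: gap_def)
  show "k < gap L k" by (rule gap_gt)
qed

section \<open>Transitivity and mean equicontinuity of the recurrent point\<close>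

lemma marked_recurrent_point: "marked L (recurrent_point L y) 0"
proof -
  have "recurrent_point L y t \<longleftrightarrow> t \<in> ones L y 0" if "t \<le> Suc L" for t
    using that gap_gt(1)[of L 0] by (intro recurrent_point_iff) simp
  then show ?thesis by (simp add: marked_def)
qed

lemma almost_mean_equicontinuous_recurrent_point:
  assumes y: "\<And>s. \<exists>i. 0 < i \<and> i \<le> L \<and> y (s + i)"
  shows "dynamical_system.almost_mean_equicontinuous (orbit_closure (recurrent_point L y)) cantor_dist shift"
proof -
  define x where "x = recurrent_point L y"
  interpret dynamical_system "orbit_closure x" cantor_dist shift
    by (rule dynamical_system_subshift[OF subshift_orbit_closure])
  have "z \<in> omega_limit x" if z: "z \<in> orbit_closure x" for z
    unfolding omega_limit_iff[OF subshift_orbit_closure orbit_closure_refl]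
  proof (intro conjI z allI)
    fix n N
    obtain p where p: "\<forall>i<n. z i = x (p + i)"
      using z unfolding orbit_closure_def by blast
    \<comment> \<open>Since \<open>k \<le> len L k\<close>, the occurrence of the prefix lies inside
      \<open>A\<^sub>k\<close>, and its copy starts beyond \<open>N\<close>.\<close>
    define k where "k = p + n + N"
    have "x (copy_pos L k + p + i) = x (p + i)" if "i < n" for i
      using recurrent_point_copy[of "p + i" L k y] le_len[of k L] that
      by (simp add: x_def k_def add.assoc)
    moreover have "N \<le> copy_pos L k + p" by (simp add: k_def)
    ultimately show "\<exists>m\<ge>N. \<forall>i<n. z i = x (m + i)"
      using p by metis
  qed
  then have "omega_limit x = orbit_closure x"
    using omega_limit_iff[OF subshift_orbit_closure orbit_closure_refl] by blast
  then have "transitive"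
    unfolding transitive_def using orbit_closure_refl by blast
  moreover have "mean_equicontinuous_point x"
    unfolding mean_equicontinuous_point_def
  \<comment> \<open>One radius serves every \<open>\<epsilon>\<close>: agreement on
    \<open>L + 2\<close> symbols forces the marker, and then the averages tend to 0.\<close>
  proof (intro conjI orbit_closure_refl allI impI exI[of _ "1 / real (L + 2)"] ballI)
    fix \<epsilon> :: real and z
    assume \<epsilon>: "0 < \<epsilon>" and z: "z \<in> orbit_closure x" "cantor_dist x z < 1 / real (L + 2)"
    have "\<forall>i<L + 2. x i = z i"
      using z(2) cantor_dist_less_iff_lessThan[of "L + 2" x z] by simp
    moreover have mx: "marked L x 0"
      unfolding x_def by (rule marked_recurrent_point)
    ultimately have "marked L z 0"
      by (simp add: marked_def)
    then have "sparse z"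
      using sparse_of_marked[OF y] z(1) by (simp add: x_def)
    moreover have "sparse x"
      using sparse_of_marked[OF y, of x] mx orbit_closure_refl by (simp add: x_def)
    ultimately have "(\<lambda>n. ereal ((\<Sum>i<n. cantor_dist ((shift ^^ i) x) ((shift ^^ i) z)) / real n)) \<longlonglongrightarrow> ereal 0"
      using sparse_mean_asymptotic by (intro tendsto_ereal)
    then have "limsup (\<lambda>n. ereal ((\<Sum>i<n. cantor_dist ((shift ^^ i) x) ((shift ^^ i) z)) / real n)) = ereal 0"
      by (intro lim_imp_Limsup) simp_all
    then show "limsup (\<lambda>n. ereal ((\<Sum>i<n. cantor_dist ((shift ^^ i) x) ((shift ^^ i) z)) / real n)) < ereal \<epsilon>"
      using \<epsilon> by simp
  qed simp
  ultimately show ?thesis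
    unfolding almost_mean_equicontinuous_def x_def[symmetric] by blast
qed

section \<open>Embedding the minimal subshift\<close>

lemma word_source_in_orbit_closure: "y \<in> orbit_closure (recurrent_point L y)"
  unfolding orbit_closure_def using recurrent_point_word by blast

text \<open>The orbit of the common point \<open>y\<close> is dense in \<open>Y\<close> and stays in
  the closed set \<open>X\<close>.\<close>

lemma minimal_subset_subshift:
  assumes Y: "subshift Y" "dynamical_system.minimal Y cantor_dist shift"
    and X: "subshift X" and y: "y \<in> X" "y \<in> Y"
  shows "Y \<subseteq> X"
proof
  fix z assume "z \<in> Y"
  interpret Y: dynamical_system Y cantor_dist shift
    by (rule dynamical_system_subshift) fact
  have "z \<in> Y.omega_limit y"
    using Y(2) y(2) \<open>z \<in> Y\<close> unfolding Y.minimal_def by blast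
  then have z: "\<exists>m. \<forall>i<n. z i = y (m + i)" for n
    unfolding omega_limit_iff[OF Y(1) y(2)] by blast
  with subshift_orbit[OF X y(1)] show "z \<in> X"
    by (intro subshift_closed[OF X]) (metis (no_types))
qed

text \<open>The orbit closure of a fixed point is a singleton subshift that meets \<open>Y\<close>,
  so it contains \<open>Y\<close>.\<close>

lemma minimal_fixed_point:
  assumes Y: "subshift Y" "dynamical_system.minimal Y cantor_dist shift"
    and w: "w \<in> Y" "shift w = w"
  shows "Y = {w}"
proof -
  have n: "(shift ^^ n) w = w" for n
    by (induction n) (simp_all add: w(2))
  have "orbit_closure w = {w}"
  proof (intro equalityI subsetI)
    fix z assume z: "z \<in> orbit_closure w"
    have "z i = w i" for i
    proof -
      obtain p where "\<forall>j<Suc i. z j = w (p + j)"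
        using z unfolding orbit_closure_def by blast
      then show ?thesis using n[of p] by (metis lessI shift_funpow)
    qed
    then show "z \<in> {w}" by auto
  qed (simp add: orbit_closure_refl)
  then have "subshift {w}"
    using subshift_orbit_closure[of w] by simp
  then show ?thesis
    using minimal_subset_subshift[OF Y, of "{w}" w] w(1) by blast
qed

theorem theorem4p7:
  fixes Y :: "binseq set"
  assumes "subshift Y"
    and "dynamical_system.minimal Y cantor_dist shift"
  shows "\<exists>X. subshift X \<and> dynamical_system.almost_mean_equicontinuous X cantor_dist shift \<and> Y \<subseteq> X"
proof (cases "(\<lambda>_. False) \<in> Y")
  case True
  interpret dynamical_system Y cantor_dist shift
    by (rule dynamical_system_subshift) fact
  have Y: "Y = {\<lambda>_. False}"
    by (rule minimal_fixed_point[OF assms True]) (simp add: shift_def)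
  have "mean_equicontinuous_point (\<lambda>_. False)"
    unfolding mean_equicontinuous_point_def
  proof (intro conjI True allI impI exI[of _ 1] ballI)
    fix \<epsilon> :: real and z
    assume "0 < \<epsilon>" "z \<in> Y"
    then show "limsup (\<lambda>n. ereal ((\<Sum>i<n. cantor_dist ((shift ^^ i) (\<lambda>_. False)) ((shift ^^ i) z)) / real n)) < ereal \<epsilon>"
      by (simp add: Y cantor_dist_def Limsup_const)
  qed simp
  moreover have "transitive"
    using assms(2) True unfolding minimal_def transitive_def by blast
  ultimately have "almost_mean_equicontinuous"
    unfolding almost_mean_equicontinuous_def by blast
  then show ?thesis using assms(1) by blast
next
  case False
  obtain y where y: "y \<in> Y"
    using assms(1) unfolding subshift_def by blast
  \<comment> \<open>Otherwise \<open>Y\<close> has points with arbitrarily long initial runs of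
    zeros, and closedness puts the zero sequence into \<open>Y\<close>.\<close>
  obtain L where L: "\<And>w. w \<in> Y \<Longrightarrow> \<exists>i<L. w i"
    using False subshift_closed[OF assms(1), of "\<lambda>_. False"] by (metis (no_types, lifting))
  have "\<exists>i. 0 < i \<and> i \<le> L \<and> y (s + i)" for s
  proof -
    \<comment> \<open>Starting at \<open>Suc s\<close> makes the offset from \<open>s\<close>
      positive.\<close>
    obtain i where "i < L" "y (Suc s + i)"
      using L[OF subshift_orbit[OF assms(1) y]] by blast
    then show ?thesis by (intro exI[of _ "Suc i"]) simp
  qed
  then have "dynamical_system.almost_mean_equicontinuous (orbit_closure (recurrent_point L y)) cantor_dist shift"
    by (rule almost_mean_equicontinuous_recurrent_point)
  moreover have "Y \<subseteq> orbit_closure (recurrent_point L y)"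
    by (rule minimal_subset_subshift[OF assms subshift_orbit_closure word_source_in_orbit_closure y])
  ultimately show ?thesis
    using subshift_orbit_closure by blast
qed

end
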